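(* Let $G$ be a finite simple graph on $n$ vertices. Then $G$ admits a strongly-separating path system of size at most $19n$; that is, there exists a collection $\mathcal{P}$ of paths in $G$ with $|\mathcal{P}| \le 19n$ such that for any two distinct edges $e$ and $f$ of $G$ there exist paths $P_e, P_f \in \mathcal{P}$ with $e \in P_e$, $e \notin P_f$, $f \in P_f$ and $f \notin P_e$.
   Context: Graphs are finite, simple and undirected. A path in a graph $G$ is a subgraph of $G$ that is a path (no repeated vertices); paths consisting of a single edge are allowed. For an edge $e$ and a path $P$, $e \in P$ means that $e$ is one of the edges of $P$. A collection $\mathcal{P}$ of paths in $G$ is a strongly-separating path system of $G$ if for any two distinct edges $e$ and $f$ of $G$ there exist paths $P_e$ and $P_f$ in $\mathcal{P}$ such that $e \in P_e$, $e \notin P_f$, $f \in P_f$ and $f \notin P_e$. The size of such a system is the number of paths in the collection. *)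

theory Defs
  imports Main
begin

record 'a ugraph =
  verts :: "'a set"
  edges :: "'a set set"

definition finite_simple_graph :: "'a ugraph \<Rightarrow> bool" where
  "finite_simple_graph G \<longleftrightarrow>
     finite (verts G) \<and> (\<forall>e\<in>edges G. e \<subseteq> verts G \<and> card e = 2)"

definition subgraph :: "'a ugraph \<Rightarrow> 'a ugraph \<Rightarrow> bool" where
  "subgraph H G \<longleftrightarrow>
     finite_simple_graph H \<and> verts H \<subseteq> verts G \<and> edges H \<subseteq> edges G"

(* A path is a graph, not a vertex sequence: the two traversal directions of a
   path give the same object, so it is counted once in the size of a path system. *)
definition path_graph :: "'a ugraph \<Rightarrow> bool" where
  "path_graph P \<longleftrightarrow>
     (\<exists>xs. xs \<noteq> [] \<and> distinct xs \<and> verts P = set xs \<and>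
           edges P = {{xs ! i, xs ! Suc i} | i. Suc i < length xs})"

definition path_in :: "'a ugraph \<Rightarrow> 'a ugraph \<Rightarrow> bool" where
  "path_in G P \<longleftrightarrow> path_graph P \<and> subgraph P G"

definition strongly_separating_path_system :: "'a ugraph \<Rightarrow> 'a ugraph set \<Rightarrow> bool" where
  "strongly_separating_path_system G \<P> \<longleftrightarrow>
     (\<forall>P\<in>\<P>. path_in G P) \<and>
     (\<forall>e\<in>edges G. \<forall>f\<in>edges G. e \<noteq> f \<longrightarrow>
        (\<exists>P\<^sub>e\<in>\<P>. \<exists>P\<^sub>f\<in>\<P>.
           e \<in> edges P\<^sub>e \<and> e \<notin> edges P\<^sub>f \<and> f \<in> edges P\<^sub>f \<and> f \<notin> edges P\<^sub>e))"

end

theory Submission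
  imports Defs
begin

text \<open>By Posa's rotation argument there are a path P and a nonempty vertex set S such that P
  contains S and all its neighbours, and these are at most 3 |S| vertices. By induction the
  graph without S has a system of 19 (n - |S|) paths, so it suffices to separate the edges
  meeting S from all other edges with 19 |S| paths. At most 2 |S| of these edges lie on P and are
  taken as single-edge paths. The others are chords of P, and a set of nested chords is covered
  by a zigzag which moves along P between consecutive chords; the two zigzags on the same chords,
  starting on different sides, share no edge of P. So the two zigzags through the chords with a
  given end sum separate a chord from everything except chords of the same sum, which a second
  family of nested chord sets distinguishes.\<close>

section \<open>Edges of vertex sequences\<close>

text \<open>Written in the index form that \<open>path_graph\<close> uses, so that vertex sequences
  become path graphs by unfolding alone.\<close>

definition path_edges :: "'a list \<Rightarrow> 'a set set" where
  "path_edges xs = {{xs ! i, xs ! Suc i} | i. Suc i < length xs}"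

lemma path_edges_Nil [simp]: "path_edges [] = {}"
  and path_edges_single [simp]: "path_edges [x] = {}"
  by (auto simp: path_edges_def)

lemma path_edges_Cons_Cons [simp]:
  "path_edges (x # y # zs) = insert {x, y} (path_edges (y # zs))"
proof (intro equalityI subsetI)
  fix e assume "e \<in> path_edges (x # y # zs)"
  then obtain i where "Suc i < length (x # y # zs)"
      "e = {(x # y # zs) ! i, (x # y # zs) ! Suc i}"
    unfolding path_edges_def by blast
  then show "e \<in> insert {x, y} (path_edges (y # zs))"
    by (cases i) (auto simp: path_edges_def)
next
  fix e assume "e \<in> insert {x, y} (path_edges (y # zs))"
  then consider "e = {x, y}"
    | i where "Suc i < length (y # zs)" "e = {(y # zs) ! i, (y # zs) ! Suc i}"
    unfolding path_edges_def by blast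
  then show "e \<in> path_edges (x # y # zs)"
  proof cases
    case 1
    then show ?thesis unfolding path_edges_def by (auto intro!: exI[of _ 0])
  next
    case (2 i)
    then show ?thesis unfolding path_edges_def by (auto intro!: exI[of _ "Suc i"])
  qed
qed

lemma path_edges_append:
  "xs \<noteq> [] \<Longrightarrow> ys \<noteq> [] \<Longrightarrow>
   path_edges (xs @ ys) = insert {last xs, hd ys} (path_edges xs \<union> path_edges ys)"
proof (induction xs rule: induct_list012)
  case (2 x)
  then show ?case by (cases ys) auto
qed auto

lemma path_edges_rev [simp]: "path_edges (rev xs) = path_edges xs"
proof (induction xs)
  case (Cons x xs)
  then show ?case
    using path_edges_append[of "rev xs" "[x]"]
    by (cases xs) (auto simp: insert_commute last_rev)
qed auto

lemma path_edges_map: "path_edges (map f xs) = (`) f ` path_edges xs"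
  by (induction xs rule: induct_list012) auto

lemma path_edges_subset: "e \<in> path_edges xs \<Longrightarrow> e \<subseteq> set xs"
  by (auto simp: path_edges_def)

lemma path_edges_upt: "path_edges [a..<b] = (\<lambda>i. {i, Suc i}) ` {a..<b - 1}"
proof (intro equalityI subsetI)
  fix e assume "e \<in> (\<lambda>i. {i, Suc i}) ` {a..<b - 1}"
  then obtain i where "e = {i, Suc i}" "a \<le> i" "Suc i < b" by auto
  then show "e \<in> path_edges [a..<b]"
    unfolding path_edges_def by (auto intro!: exI[of _ "i - a"])
qed (auto simp: path_edges_def)

lemma card_path_neighbours:
  assumes "distinct P"
  shows "finite {x. {s, x} \<in> path_edges P}" "card {x. {s, x} \<in> path_edges P} \<le> 2"
proof -
  have "\<exists>a b. {x. {s, x} \<in> path_edges P} \<subseteq> {a, b}"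
  proof (cases "s \<in> set P")
    case True
    then obtain i where i: "i < length P" "s = P ! i" by (metis in_set_conv_nth)
    \<comment> \<open>For \<open>i = 0\<close> the term \<open>P ! (i - 1)\<close> is
      \<open>s\<close> itself, which merely enlarges the two-element superset.\<close>
    have "x = P ! Suc i \<or> x = P ! (i - 1)" if "{s, x} \<in> path_edges P" for x
    proof -
      from that obtain k where k: "Suc k < length P" "{s, x} = {P ! k, P ! Suc k}"
        unfolding path_edges_def by blast
      then consider "s = P ! k" "x = P ! Suc k" | "s = P ! Suc k" "x = P ! k"
        by (auto simp: doubleton_eq_iff)
      then show ?thesis
        using i k assms by cases (auto simp: nth_eq_iff_index_eq)
    qed
    then show ?thesis by blast
  next
    case False
    then show ?thesis using path_edges_subset by fastforce
  qed
  then obtain a b where ab: "{x. {s, x} \<in> path_edges P} \<subseteq> {a, b}" by blast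
  show "finite {x. {s, x} \<in> path_edges P}"
    using ab by (rule finite_subset) simp
  show "card {x. {s, x} \<in> path_edges P} \<le> 2"
    using card_mono[OF _ ab] card_insert_le_m1[of 2 "{b}" a] by simp
qed

definition vertex_path :: "'a set \<Rightarrow> 'a set set \<Rightarrow> 'a list \<Rightarrow> bool" where
  "vertex_path V E xs \<longleftrightarrow> distinct xs \<and> set xs \<subseteq> V \<and> path_edges xs \<subseteq> E"

text \<open>Letting the avoided set range over arbitrary sets makes the notion include
  that every edge is covered, and makes it compatible with unions.\<close>

definition separates :: "'a list set \<Rightarrow> 'a set set \<Rightarrow> bool" where
  "separates L E \<longleftrightarrow>
     (\<forall>e\<in>E. \<forall>f. f \<noteq> e \<longrightarrow> (\<exists>xs\<in>L. e \<in> path_edges xs \<and> f \<notin> path_edges xs))"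

lemma separates_Un:
  "separates L E \<Longrightarrow> separates L' E' \<Longrightarrow> separates (L \<union> L') (E \<union> E')"
  unfolding separates_def Bex_def Ball_def Un_iff by metis

lemma separates_mono: "separates L E \<Longrightarrow> E' \<subseteq> E \<Longrightarrow> separates L E'"
  unfolding separates_def by auto

section \<open>Rotations of a longest path\<close>

text \<open>A step trades the edge from \<open>w\<close> to \<open>hd B\<close> for the edge from
  \<open>w\<close> to the end \<open>last B\<close>. Then \<open>hd B\<close> is the new end, while
  the first vertex stays fixed.\<close>

inductive rotation :: "'a set set \<Rightarrow> 'a list \<Rightarrow> 'a list \<Rightarrow> bool" for E P where
  refl: "rotation E P P"
| step: "rotation E P (A @ w # B) \<Longrightarrow> B \<noteq> [] \<Longrightarrow> {w, last B} \<in> E \<Longrightarrow>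
         rotation E P (A @ w # rev B)"

text \<open>Since reversal preserves \<open>path_edges B\<close>, this decomposition reduces a
  rotation to the exchange of one edge at the pivot.\<close>

lemma path_edges_pivot:
  "B \<noteq> [] \<Longrightarrow> path_edges (A @ w # B) = insert {w, hd B} (path_edges (A @ [w]) \<union> path_edges B)"
  using path_edges_append[of "A @ [w]" B] by simp

lemma rotation_path:
  assumes "rotation E P Q" "vertex_path V E P"
  shows "vertex_path V E Q \<and> length Q = length P \<and> set Q = set P"
  using assms
proof (induction rule: rotation.induct)
  case (step A w B)
  then show ?case
    by (auto simp: vertex_path_def path_edges_pivot hd_rev)
qed auto

text \<open>The only edge gained by a step joins the pivot to the old end, so it suffices that
  \<open>w\<close> is neither of them. The hypothesis on \<open>w\<close> excludes the end directly
  and the pivot by induction.\<close>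

lemma rotation_keeps_edges:
  assumes "rotation E P Q" "Q \<noteq> []"
    and "\<And>Q. rotation E P Q \<Longrightarrow> Q \<noteq> [] \<Longrightarrow> w \<noteq> last Q \<and> {w, last Q} \<notin> path_edges P"
    and "{w, x} \<in> path_edges Q"
  shows "{w, x} \<in> path_edges P"
  using assms(1,2,4)
proof (induction arbitrary: x rule: rotation.induct)
  case (step A v B)
  have "last B \<noteq> w"
    using assms(3)[OF step.hyps(1)] step.hyps(2) by auto
  \<comment> \<open>As a pivot, \<open>w\<close> would be adjacent to \<open>hd B\<close> before the
    step, hence also in \<open>P\<close> by induction; but \<open>hd B\<close> is the end after the
    step.\<close>
  moreover have "w \<noteq> v"
  proof
    assume "w = v"
    then have "{w, hd B} \<in> path_edges (A @ v # B)"
      using step.hyps(2) by (simp add: path_edges_pivot)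
    then have "{w, hd B} \<in> path_edges P"
      using step.IH by simp
    moreover have "last (A @ v # rev B) = hd B"
      using step.hyps(2) by (simp add: last_rev)
    ultimately show False
      using assms(3)[OF rotation.step[OF step.hyps]] by simp
  qed
  ultimately have "{w, x} \<in> path_edges (A @ v # B)"
    using step.prems step.hyps(2)
    by (auto simp: path_edges_pivot hd_rev doubleton_eq_iff)
  then show ?case using step.IH by simp
qed

lemma exists_longest_path:
  assumes "finite V" "V \<noteq> {}"
  obtains P where "vertex_path V E P" "P \<noteq> []"
    "\<And>Q. vertex_path V E Q \<Longrightarrow> length Q \<le> length P"
proof -
  obtain v where "v \<in> V" using assms by blast
  then have v: "vertex_path V E [v]" by (simp add: vertex_path_def)
  have "length Q \<le> card V" if "vertex_path V E Q" for Q
    using that assms by (metis vertex_path_def card_mono distinct_card)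
  then obtain P where P: "vertex_path V E P" "\<And>Q. vertex_path V E Q \<Longrightarrow> length Q \<le> length P"
    using ex_has_greatest_nat[of "vertex_path V E" "[v]" length "Suc (card V)"] v
    by (auto simp: less_Suc_eq_le)
  moreover have "P \<noteq> []" using P(2)[OF v] by auto
  ultimately show thesis using that by blast
qed

text \<open>Posa's lemma: take for S the end vertices of all rotations of a longest path.\<close>

lemma posa:
  assumes fin: "finite V" and ne: "V \<noteq> {}" and E: "\<forall>e\<in>E. e \<subseteq> V \<and> card e = 2"
  obtains P S where "vertex_path V E P" "S \<noteq> {}" "S \<subseteq> set P"
    "\<forall>u\<in>S. \<forall>w. {u, w} \<in> E \<longrightarrow> w \<in> set P"
    "card (S \<union> {w. \<exists>u\<in>S. {u, w} \<in> E}) \<le> 3 * card S"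
proof -
  obtain P where P: "vertex_path V E P" "P \<noteq> []"
    and longest: "\<And>Q. vertex_path V E Q \<Longrightarrow> length Q \<le> length P"
    using exists_longest_path[OF fin ne] by blast
  define S where "S = last ` {Q. rotation E P Q}"
  define N where "N = {w. \<exists>u\<in>S. {u, w} \<in> E}"
  have rot: "vertex_path V E Q \<and> length Q = length P \<and> set Q = set P \<and> Q \<noteq> []"
    if "rotation E P Q" for Q
    using rotation_path[OF that P(1)] P(2) by auto
  have S_P: "S \<subseteq> set P" using rot unfolding S_def by fastforce
  have "S \<noteq> {}" unfolding S_def using rotation.refl by blast
  have nbr: "w \<in> set P \<and> (w \<in> S \<or> (\<exists>s\<in>S. {s, w} \<in> path_edges P))"
    if "u \<in> S" and uw: "{u, w} \<in> E" for u w
  proof -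
    obtain Q where Q: "rotation E P Q" "last Q = u" using \<open>u \<in> S\<close> S_def by auto
    have "u \<noteq> w" using E uw by auto
    \<comment> \<open>Otherwise \<open>Q @ [w]\<close> would be a longer path.\<close>
    have w: "w \<in> set Q"
    proof (rule ccontr)
      assume "w \<notin> set Q"
      moreover have "w \<in> V" using E uw by blast
      ultimately have "vertex_path V E (Q @ [w])"
        using rot[OF Q(1)] uw Q(2) by (auto simp: vertex_path_def path_edges_append)
      then show False using longest rot[OF Q(1)] by fastforce
    qed
    then obtain A B where AB: "Q = A @ w # B" by (meson split_list)
    have B: "B \<noteq> []" using AB Q(2) \<open>u \<noteq> w\<close> by auto
    then have "{w, last B} \<in> E" using AB Q(2) uw by (simp add: insert_commute)
    then have Q': "rotation E P (A @ w # rev B)" using rotation.step[of E P A w B] Q(1) AB B by simp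
    \<comment> \<open>Rotating \<open>Q\<close> at \<open>w\<close> along the edge to
      \<open>u\<close> turns the successor of \<open>w\<close> into an end vertex.\<close>
    have hdB: "hd B \<in> S"
      unfolding S_def using Q' B by (auto simp: last_rev intro!: image_eqI)
    have "w \<in> S \<or> (\<exists>s\<in>S. {s, w} \<in> path_edges P)"
    proof (rule ccontr)
      \<comment> \<open>If \<open>w\<close> is neither an end vertex nor next to one on
        \<open>P\<close>, its edges in \<open>Q\<close> all come from \<open>P\<close>. The edge to
        \<open>hd B\<close> then puts \<open>w\<close> next to an end vertex on \<open>P\<close>
        after all.\<close>
      assume neg: "\<not> ?thesis"
      have "{w, hd B} \<in> path_edges P"
      proof (rule rotation_keeps_edges[OF Q(1)])
        show "Q \<noteq> []" using rot[OF Q(1)] by simp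
        show "{w, hd B} \<in> path_edges Q" using AB B by (simp add: path_edges_pivot)
        fix R assume "rotation E P R"
        then have "last R \<in> S" by (simp add: S_def)
        then show "w \<noteq> last R \<and> {w, last R} \<notin> path_edges P"
          using neg by (auto simp: insert_commute)
      qed
      then show False using neg hdB by (auto simp: insert_commute)
    qed
    then show ?thesis using w rot[OF Q(1)] by simp
  qed
  have dP: "distinct P" using P by (simp add: vertex_path_def)
  have finS: "finite S" using S_P finite_subset by blast
  \<comment> \<open>Each vertex of \<open>S\<close> contributes itself and at most two neighbours on
    \<open>P\<close>, whence the factor 3.\<close>
  let ?R = "\<lambda>s. {x. {s, x} \<in> path_edges P}"
  have "S \<union> N \<subseteq> S \<union> (\<Union>s\<in>S. ?R s)" unfolding N_def using nbr by auto
  then have "card (S \<union> N) \<le> card (S \<union> (\<Union>s\<in>S. ?R s))"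
    using finS card_path_neighbours(1)[OF dP] by (intro card_mono) auto
  also have "\<dots> \<le> card S + card (\<Union>s\<in>S. ?R s)" by (rule card_Un_le)
  also have "card (\<Union>s\<in>S. ?R s) \<le> (\<Sum>s\<in>S. card (?R s))" by (rule card_UN_le[OF finS])
  also have "\<dots> \<le> (\<Sum>s\<in>S. 2)" by (intro sum_mono card_path_neighbours[OF dP])
  finally have "card (S \<union> N) \<le> 3 * card S" by simp
  then show thesis
    using that[OF P(1) \<open>S \<noteq> {}\<close> S_P] nbr unfolding N_def by blast
qed

section \<open>Zigzags through nested chords\<close>

definition chords :: "(nat \<times> nat) set \<Rightarrow> nat set set" where
  "chords C = (\<lambda>(i, j). {i, j}) ` C"

lemma chords_simps [simp]:
  "chords {} = {}" "chords (insert (i, j) C) = insert {i, j} (chords C)"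
  "chords (C \<union> D) = chords C \<union> chords D"
  by (auto simp: chords_def)

text \<open>Vertices of \<open>P\<close> are represented by their positions, so steps stand for
  edges of \<open>P\<close>. They range over all naturals; the bound on the vertices of a zigzag
  keeps them within \<open>P\<close>.\<close>

definition steps :: "nat set set" where
  "steps = range (\<lambda>i. {i, Suc i})"

abbreviation encloses :: "nat \<times> nat \<Rightarrow> nat \<times> nat \<Rightarrow> bool" where
  "encloses \<equiv> \<lambda>(l, r) (l', r'). l < l' \<and> r' < r"

text \<open>The chords are listed from the outermost inwards; the flag tells whether the
  sequence starts at the left or at the right end of the outermost chord.\<close>

fun zigzag :: "bool \<Rightarrow> (nat \<times> nat) list \<Rightarrow> nat list" where
  "zigzag b [] = []"
| "zigzag b [(l, r)] = (if b then [l, r] else [r, l])"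
| "zigzag b ((l, r) # (l', r') # es) =
     (if b then l # rev [Suc r'..<Suc r] @ zigzag False ((l', r') # es)
      else r # [l..<l'] @ zigzag True ((l', r') # es))"

text \<open>The vertices added for the outer chord lie outside the interval of the next chord, in
  which the rest of the zigzag stays. The first vertex is recorded because it determines the edge
  linking the run to the rest.\<close>

lemma zigzag_Cons:
  assumes "sorted_wrt encloses ((l, r) # es)" "\<forall>(i, j)\<in>set ((l, r) # es). i < j"
  shows "zigzag b ((l, r) # es) \<noteq> [] \<and>
    hd (zigzag b ((l, r) # es)) = (if b then l else r) \<and>
    set (zigzag b ((l, r) # es)) \<subseteq> {l..r} \<and>
    distinct (zigzag b ((l, r) # es))"
  using assms
proof (induction es arbitrary: b l r)
  case (Cons e es)
  obtain l' r' where e: "e = (l', r')" by fastforce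
  have o: "l < l'" "l' < r'" "r' < r" using Cons.prems e by auto
  have IH: "set (zigzag b' ((l', r') # es)) \<subseteq> {l'..r'}" "distinct (zigzag b' ((l', r') # es))" for b'
    using Cons.IH[of l' r' b'] Cons.prems e by auto
  have mem: "l' \<le> x \<and> x \<le> r'" if "x \<in> set (zigzag b' ((l', r') # es))" for x b'
    using IH(1) that by fastforce
  show ?case
  proof (cases b)
    case True
    then have "zigzag b ((l, r) # e # es) = l # rev [Suc r'..<Suc r] @ zigzag False ((l', r') # es)"
      by (simp add: e)
    then show ?thesis using True o IH(2)[of False]
      by (auto simp del: upt_Suc zigzag.simps dest: mem)
  next
    case False
    then have "zigzag b ((l, r) # e # es) = r # [l..<l'] @ zigzag True ((l', r') # es)"
      by (simp add: e)
    then show ?thesis using False o IH(2)[of True]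
      by (auto simp del: zigzag.simps dest: mem)
  qed
qed auto

text \<open>Starting on the left means crossing to the right end and descending there, so the next
  chord is entered from the right: the flag flips. The run includes the edge linking it to that
  chord.\<close>

lemma path_edges_zigzag_Cons_Cons:
  assumes "sorted_wrt encloses ((l, r) # (l', r') # es)"
    and "\<forall>(i, j)\<in>set ((l, r) # (l', r') # es). i < j"
  shows "path_edges (zigzag b ((l, r) # (l', r') # es)) =
    insert {l, r} ((\<lambda>i. {i, Suc i}) ` (if b then {r'..<r} else {l..<l'}) \<union>
      path_edges (zigzag (\<not> b) ((l', r') # es)))"
proof -
  have o: "l < l'" "l' < r'" "r' < r" using assms by auto
  have z: "zigzag b' ((l', r') # es) \<noteq> []"
      "hd (zigzag b' ((l', r') # es)) = (if b' then l' else r')" for b'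
    using zigzag_Cons[of l' r' es b'] assms by auto
  show ?thesis
  proof (cases b)
    case True
    have "path_edges (rev [Suc r'..<Suc r] @ zigzag False ((l', r') # es)) =
       insert {Suc r', r'} (path_edges [Suc r'..<Suc r] \<union> path_edges (zigzag False ((l', r') # es)))"
      using o z[of False] by (subst path_edges_append) (auto simp: last_rev simp del: upt_Suc)
    then have "path_edges (zigzag b ((l, r) # (l', r') # es)) =
      insert {l, r} (insert {Suc r', r'} (path_edges [Suc r'..<Suc r]) \<union>
        path_edges (zigzag False ((l', r') # es)))"
      using True o path_edges_append[of "[l]" "rev [Suc r'..<Suc r] @ zigzag False ((l', r') # es)"]
      by (simp add: hd_rev)
    moreover have "{r'..<r} = insert r' {Suc r'..<r}" using o by auto
    then have "insert {Suc r', r'} (path_edges [Suc r'..<Suc r]) = (\<lambda>i. {i, Suc i}) ` {r'..<r}"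
      unfolding path_edges_upt by (simp add: insert_commute)
    ultimately show ?thesis using True by (simp only: if_True simp_thms)
  next
    case False
    have "path_edges ([l..<l'] @ zigzag True ((l', r') # es)) =
       insert {l' - 1, l'} (path_edges [l..<l'] \<union> path_edges (zigzag True ((l', r') # es)))"
      using o z[of True] by (subst path_edges_append) (auto simp: last_rev simp del: upt_Suc)
    then have "path_edges (zigzag b ((l, r) # (l', r') # es)) =
      insert {l, r} (insert {l' - 1, l'} (path_edges [l..<l']) \<union>
        path_edges (zigzag True ((l', r') # es)))"
      using False o path_edges_append[of "[r]" "[l..<l'] @ zigzag True ((l', r') # es)"]
      by (simp add: insert_commute)
    moreover have "{l..<l'} = insert (l' - 1) {l..<l' - 1}" "Suc (l' - 1) = l'" using o by auto
    then have "insert {l' - 1, l'} (path_edges [l..<l']) = (\<lambda>i. {i, Suc i}) ` {l..<l'}"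
      unfolding path_edges_upt by simp
    ultimately show ?thesis using False by (simp only: if_False simp_thms)
  qed
qed

text \<open>For the third claim: between consecutive chords one zigzag moves along the left side and
  the other along the right side. No edge of either run lies within the inner interval, so only
  chords are common.\<close>

lemma path_edges_zigzag:
  assumes "sorted_wrt encloses es" "\<forall>(i, j)\<in>set es. i < j"
  shows "chords (set es) \<subseteq> path_edges (zigzag b es)"
    and "path_edges (zigzag b es) \<subseteq> chords (set es) \<union> steps"
    and "path_edges (zigzag True es) \<inter> path_edges (zigzag False es) \<subseteq> chords (set es)"
proof -
  have "chords (set es) \<subseteq> path_edges (zigzag b es) \<and>
     path_edges (zigzag b es) \<subseteq> chords (set es) \<union> steps"
    using assms
  proof (induction b es rule: zigzag.induct)
    case (3 b l r l' r' es)
    have "sorted_wrt encloses ((l', r') # es)" "\<forall>(i, j)\<in>set ((l', r') # es). i < j"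
      using "3.prems" by auto
    then have "chords (set ((l', r') # es)) \<subseteq> path_edges (zigzag (\<not> b) ((l', r') # es)) \<and>
        path_edges (zigzag (\<not> b) ((l', r') # es)) \<subseteq> chords (set ((l', r') # es)) \<union> steps"
      using "3.IH" by (cases b) simp_all
    then show ?case
      unfolding path_edges_zigzag_Cons_Cons[OF "3.prems"] by (auto simp: steps_def)
  qed (auto simp: insert_commute)
  then show "chords (set es) \<subseteq> path_edges (zigzag b es)"
    and "path_edges (zigzag b es) \<subseteq> chords (set es) \<union> steps" by auto
  show "path_edges (zigzag True es) \<inter> path_edges (zigzag False es) \<subseteq> chords (set es)"
    using assms
  proof (induction es rule: induct_list012)
    case (3 e e' es)
    obtain l r where e: "e = (l, r)" by fastforce
    obtain l' r' where e': "e' = (l', r')" by fastforce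
    have o: "l < l'" "l' < r'" "r' < r" using 3 e e' by auto
    have sub: "f \<subseteq> {l'..r'}" if "f \<in> path_edges (zigzag b' ((l', r') # es))" for f b'
      using zigzag_Cons[of l' r' es b'] path_edges_subset[OF that] 3 e e' by auto
    have IH: "path_edges (zigzag True ((l', r') # es)) \<inter> path_edges (zigzag False ((l', r') # es))
        \<subseteq> chords (set ((l', r') # es))"
      using 3 e' by auto
    show ?case
    proof
      fix f assume "f \<in> path_edges (zigzag True (e # e' # es)) \<inter> path_edges (zigzag False (e # e' # es))"
      \<comment> \<open>Unless \<open>f\<close> is the outer chord, each zigzag has it in its own
        run or in its inner part; only the case of both inner parts survives.\<close>
      then have "f = {l, r} \<or> ((\<exists>i. r' \<le> i \<and> f = {i, Suc i}) \<or> f \<in> path_edges (zigzag False ((l', r') # es))) \<and>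
         ((\<exists>i. i < l' \<and> f = {i, Suc i}) \<or> f \<in> path_edges (zigzag True ((l', r') # es)))"
        using 3 unfolding e e' by (auto simp: path_edges_zigzag_Cons_Cons simp del: zigzag.simps)
      moreover have "False" if "f = {i, Suc i}" "r' \<le> i" "f = {k, Suc k}" "k < l'" for i k
        using that o by (auto simp: doubleton_eq_iff)
      moreover have "f \<notin> path_edges (zigzag b' ((l', r') # es))"
        if "f = {i, Suc i}" "r' \<le> i \<or> i < l'" for i b'
        using sub[of f b'] that by auto
      ultimately have "f = {l, r} \<or> f \<in> chords (set ((l', r') # es))"
        using IH by blast
      then show "f \<in> chords (set (e # e' # es))"
        unfolding e e' by auto
    qed
  qed auto
qed

section \<open>Sorting nested chords and joining two zigzags\<close>

definition nested :: "(nat \<times> nat) set \<Rightarrow> bool" where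
  "nested C \<longleftrightarrow> (\<forall>e\<in>C. \<forall>f\<in>C. e \<noteq> f \<longrightarrow> encloses e f \<or> encloses f e)"

text \<open>Distinct chords of a nested set have different left ends and are comparable, so the one
  with the least left end encloses the others and heads the list.\<close>

lemma nested_list:
  assumes "finite C" "nested C"
  obtains es where "set es = C" "sorted_wrt encloses es"
proof -
  have "\<exists>es. set es = C \<and> sorted_wrt encloses es"
    using assms
  proof (induction "card C" arbitrary: C)
    case (Suc k)
    then have "C \<noteq> {}" by auto
    then obtain e where e: "e \<in> C" "\<And>f. f \<in> C \<Longrightarrow> fst e \<le> fst f"
      using Suc.prems(1) by (metis arg_min_if_finite(1) arg_min_least)
    have "card (C - {e}) = k" "nested (C - {e})"
      using Suc e by (auto simp: nested_def)
    then obtain es where es: "set es = C - {e}" "sorted_wrt encloses es"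
      using Suc.hyps(1)[of "C - {e}"] Suc.prems(1) by auto
    have "encloses e f" if "f \<in> C - {e}" for f
      using that e Suc.prems(2) unfolding nested_def by fastforce
    then have "sorted_wrt encloses (e # es)" "set (e # es) = C" using es e by auto
    then show ?case by blast
  qed auto
  then show thesis using that by blast
qed

text \<open>The flags make both zigzags open towards the gap: reversed, the one on \<open>es\<close>
  stops at the right end of its outermost chord, and the one on \<open>fs\<close> starts at the left
  end of its own.\<close>

definition joined_zigzag :: "(nat \<times> nat) list \<Rightarrow> (nat \<times> nat) list \<Rightarrow> nat list" where
  "joined_zigzag es fs =
     (if es = [] then zigzag True fs
      else if fs = [] then zigzag False es
      else rev (zigzag False es) @ [Suc (snd (hd es))..<fst (hd fs)] @ zigzag True fs)"

text \<open>The partners \<open>zigzag True es\<close> and \<open>zigzag False fs\<close> have the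
  flags opposite to those used inside the joined path. The two zigzags and the gap share no edges,
  so each overlap reduces to that of two opposite zigzags on one list.\<close>

lemma joined_zigzag:
  assumes es: "sorted_wrt encloses es" "\<forall>(i, j)\<in>set es. i < j"
    and fs: "sorted_wrt encloses fs" "\<forall>(i, j)\<in>set fs. i < j"
    and sep: "\<forall>(i, j)\<in>set es. \<forall>(k, l)\<in>set fs. j < k"
    and N: "\<forall>(i, j)\<in>set es \<union> set fs. j < N"
  shows "distinct (joined_zigzag es fs) \<and> set (joined_zigzag es fs) \<subseteq> {..<N} \<and>
    chords (set es \<union> set fs) \<subseteq> path_edges (joined_zigzag es fs) \<and>
    path_edges (joined_zigzag es fs) \<subseteq> chords (set es \<union> set fs) \<union> steps \<and>
    path_edges (joined_zigzag es fs) \<inter> path_edges (zigzag True es) \<subseteq> chords (set es) \<and>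
    path_edges (joined_zigzag es fs) \<inter> path_edges (zigzag False fs) \<subseteq> chords (set fs)"
proof (cases es)
  case Nil
  show ?thesis
  proof (cases fs)
    case Nil
    then show ?thesis using \<open>es = []\<close> by (simp add: joined_zigzag_def)
  next
    case (Cons f fs')
    obtain l r where f: "f = (l, r)" by fastforce
    have "distinct (zigzag True fs)" "set (zigzag True fs) \<subseteq> {l..r}" "r < N"
      using zigzag_Cons[of l r fs' True] fs N unfolding Cons f by auto
    moreover from this have "set (zigzag True fs) \<subseteq> {..<N}" by fastforce
    moreover have "joined_zigzag es fs = zigzag True fs" by (simp add: joined_zigzag_def Nil)
    ultimately show ?thesis
      using Nil path_edges_zigzag(1,2)[OF fs, where b = True] path_edges_zigzag(3)[OF fs]
      by simp
  qed
next
  case (Cons e es')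
  obtain l r where e: "e = (l, r)" by fastforce
  have zes: "zigzag b es \<noteq> []" "hd (zigzag b es) = (if b then l else r)"
    "set (zigzag b es) \<subseteq> {l..r}" "distinct (zigzag b es)" for b
    using zigzag_Cons[of l r es' b] es Cons e by auto
  have rN: "r < N" using N Cons e by auto
  show ?thesis
  proof (cases fs)
    case Nil
    have "set (zigzag False es) \<subseteq> {..<N}" using zes(3)[of False] rN by fastforce
    moreover have "joined_zigzag es fs = zigzag False es"
      using Nil Cons by (simp add: joined_zigzag_def)
    ultimately show ?thesis
      using Nil zes(4)[of False] path_edges_zigzag(1,2)[OF es, where b = False]
        path_edges_zigzag(3)[OF es]
      by (simp add: Int_commute)
  next
    case fCons: (Cons f fs')
    obtain l' r' where f: "f = (l', r')" by fastforce
    have zfs: "zigzag b fs \<noteq> []" "hd (zigzag b fs) = (if b then l' else r')"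
      "set (zigzag b fs) \<subseteq> {l'..r'}" "distinct (zigzag b fs)" for b
      using zigzag_Cons[of l' r' fs' b] fs fCons f by auto
    have rN': "r' < N" "r < l'" "l' < r'" using N sep fs Cons fCons e f by auto
    let ?m = "[Suc r..<l']"
    have J: "joined_zigzag es fs = rev (zigzag False es) @ ?m @ zigzag True fs"
      using Cons fCons e f by (simp add: joined_zigzag_def)
    \<comment> \<open>The gap list is empty if \<open>Suc r = l'\<close>; the edge
      \<open>{r, Suc r}\<close> then leads straight into the zigzag on \<open>fs\<close>.\<close>
    have m: "path_edges (?m @ zigzag True fs) \<subseteq>
        (\<lambda>i. {i, Suc i}) ` {Suc r..<l'} \<union> path_edges (zigzag True fs) \<and>
        path_edges (zigzag True fs) \<subseteq> path_edges (?m @ zigzag True fs) \<and>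
        hd (?m @ zigzag True fs) = Suc r"
    proof (cases "Suc r = l'")
      case True
      then show ?thesis using zfs by auto
    next
      case False
      then have "?m \<noteq> []" "last ?m = l' - 1" using rN' by auto
      moreover have "{l' - 1, l'} = {l' - 1, Suc (l' - 1)}" using rN' by auto
      then have "{l' - 1, l'} \<in> (\<lambda>i. {i, Suc i}) ` {Suc r..<l'}"
        using rN' False by auto
      ultimately show ?thesis
        using zfs[of True] by (auto simp: path_edges_append path_edges_upt)
    qed
    have "path_edges (joined_zigzag es fs) =
       insert {r, Suc r} (path_edges (zigzag False es) \<union> path_edges (?m @ zigzag True fs))"
      using path_edges_append[of "rev (zigzag False es)" "?m @ zigzag True fs"]
        zes(1,2)[of False] zfs(1)[of True] m
      by (simp add: J last_rev)
    note E = this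
    \<comment> \<open>All steps from \<open>r\<close> to \<open>l'\<close>, linking edges included;
      none of them is contained in \<open>{l..r}\<close> or in \<open>{l'..r'}\<close>.\<close>
    define I where "I = (\<lambda>i. {i, Suc i}) ` {r..<l'}"
    have "{r..<l'} = insert r {Suc r..<l'}" using rN' by auto
    then have I: "I = insert {r, Suc r} ((\<lambda>i. {i, Suc i}) ` {Suc r..<l'})" by (simp add: I_def)
    have sub: "path_edges (joined_zigzag es fs) \<subseteq> I \<union>
        (path_edges (zigzag False es) \<union> path_edges (zigzag True fs))"
      and sup: "path_edges (zigzag False es) \<union> path_edges (zigzag True fs) \<subseteq> path_edges (joined_zigzag es fs)"
      unfolding E I using m by (simp_all add: Un_assoc) auto
    \<comment> \<open>Nonemptiness matters because an empty set would be contained in both disjoint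
      intervals.\<close>
    have es_sub: "g \<subseteq> {l..r}" "g \<noteq> {}" if "g \<in> path_edges (zigzag b es)" for b g
      using path_edges_subset[OF that] zes[of b] that by (auto simp: path_edges_def)
    have fs_sub: "g \<subseteq> {l'..r'}" "g \<noteq> {}" if "g \<in> path_edges (zigzag b fs)" for b g
      using path_edges_subset[OF that] zfs[of b] that by (auto simp: path_edges_def)
    have 1: "g \<in> chords (set es)"
      if "g \<in> path_edges (joined_zigzag es fs)" "g \<in> path_edges (zigzag True es)" for g
    proof -
      have "g \<notin> path_edges (zigzag True fs)"
        using es_sub[OF that(2)] fs_sub[of g True] rN' by fastforce
      moreover have "g \<notin> I"
        using es_sub[OF that(2)] by (auto simp: I_def)
      ultimately show ?thesis using sub that path_edges_zigzag(3)[OF es] by blast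
    qed
    have 2: "g \<in> chords (set fs)"
      if "g \<in> path_edges (joined_zigzag es fs)" "g \<in> path_edges (zigzag False fs)" for g
    proof -
      have "g \<notin> path_edges (zigzag False es)"
        using fs_sub[OF that(2)] es_sub[of g False] rN' by fastforce
      moreover have "g \<notin> I"
        using fs_sub[OF that(2)] by (auto simp: I_def)
      ultimately show ?thesis using sub that path_edges_zigzag(3)[OF fs] by blast
    qed
    have "distinct (joined_zigzag es fs)"
      unfolding J using zes[of False] zfs[of True] rN' by fastforce
    moreover have "set (joined_zigzag es fs) \<subseteq> {..<N}"
      unfolding J using zes(3)[of False] zfs(3)[of True] rN' by fastforce
    moreover have "chords (set es \<union> set fs) \<subseteq> path_edges (joined_zigzag es fs)"
      using sup path_edges_zigzag(1)[OF es, of False] path_edges_zigzag(1)[OF fs, of True] by auto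
    moreover have "I \<subseteq> steps" by (auto simp: steps_def I_def)
    then have "path_edges (joined_zigzag es fs) \<subseteq> chords (set es \<union> set fs) \<union> steps"
      using sub path_edges_zigzag(2)[OF es, of False] path_edges_zigzag(2)[OF fs, of True] 
      by auto
    ultimately show ?thesis using 1 2 by blast
  qed
qed

lemma nested_empty [simp]: "nested {}"
  by (simp add: nested_def)

text \<open>The path \<open>A\<close> is shared: paired with \<open>B\<close> it isolates
  \<open>C\<close>, paired with \<open>B'\<close> it isolates \<open>D\<close>. Thus two sets cost
  three paths instead of four.\<close>

definition path_triple ::
  "nat \<Rightarrow> (nat \<times> nat) set \<Rightarrow> (nat \<times> nat) set \<Rightarrow> nat list \<Rightarrow> nat list \<Rightarrow> nat list \<Rightarrow> bool" where
  "path_triple N C D A B B' \<longleftrightarrow>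
     (\<forall>z\<in>{A, B, B'}. distinct z \<and> set z \<subseteq> {..<N}) \<and>
     chords (C \<union> D) \<subseteq> path_edges A \<and> path_edges A \<subseteq> chords (C \<union> D) \<union> steps \<and>
     chords C \<subseteq> path_edges B \<and> path_edges B \<subseteq> chords C \<union> steps \<and>
     chords D \<subseteq> path_edges B' \<and> path_edges B' \<subseteq> chords D \<union> steps \<and>
     path_edges A \<inter> path_edges B \<subseteq> chords C \<and> path_edges A \<inter> path_edges B' \<subseteq> chords D"

lemma path_triple_exists:
  assumes "finite C" "finite D" "nested C" "nested D"
    and "\<forall>(i, j)\<in>C \<union> D. i < j \<and> j < N" and "\<forall>(i, j)\<in>C. \<forall>(k, l)\<in>D. j < k"
  shows "\<exists>A B B'. path_triple N C D A B B'"
proof -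
  obtain es where es: "set es = C" "sorted_wrt encloses es" using nested_list assms by blast
  obtain fs where fs: "set fs = D" "sorted_wrt encloses fs" using nested_list assms by blast
  have lt: "\<forall>(i, j)\<in>set es. i < j" "\<forall>(i, j)\<in>set fs. i < j"
    and N: "\<forall>(i, j)\<in>set es \<union> set fs. j < N" using assms es fs by auto
  have sub: "distinct (zigzag b gs) \<and> set (zigzag b gs) \<subseteq> {..<N}"
    if gs: "sorted_wrt encloses gs" "\<forall>(i, j)\<in>set gs. i < j" "\<forall>(i, j)\<in>set gs. j < N" for b gs
  proof (cases gs)
    case (Cons g gs')
    obtain l r where "g = (l, r)" by fastforce
    then show ?thesis
      using zigzag_Cons[of l r gs' b] gs Cons by fastforce
  qed auto
  have "\<forall>(i, j)\<in>set es. \<forall>(k, l)\<in>set fs. j < k" using assms(6) es fs by simp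
  note J = joined_zigzag[OF es(2) lt(1) fs(2) lt(2) this N]
  have "path_triple N C D (joined_zigzag es fs) (zigzag True es) (zigzag False fs)"
    unfolding path_triple_def
    using J sub[OF es(2) lt(1)] sub[OF fs(2) lt(2)] N
      path_edges_zigzag(1,2)[OF es(2) lt(1), of True] path_edges_zigzag(1,2)[OF fs(2) lt(2), of False]
    unfolding es(1) fs(1) by auto
  then show ?thesis by blast
qed

text \<open>No partner path is asked for: this serves to avoid an edge already known not to be a
  step.\<close>

definition covering_path :: "nat \<Rightarrow> nat set set \<Rightarrow> nat list \<Rightarrow> bool" where
  "covering_path N X z \<longleftrightarrow>
     distinct z \<and> set z \<subseteq> {..<N} \<and> X \<subseteq> path_edges z \<and> path_edges z \<subseteq> X \<union> steps"

corollary covering_path_exists: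
  assumes "finite C" "finite D" "nested C" "nested D"
    and "\<forall>(i, j)\<in>C \<union> D. i < j \<and> j < N" and "\<forall>(i, j)\<in>C. \<forall>(k, l)\<in>D. j < k"
  shows "\<exists>z. covering_path N (chords (C \<union> D)) z"
proof -
  obtain A B B' where "path_triple N C D A B B'" using path_triple_exists[OF assms] by blast
  then show ?thesis by (intro exI[of _ A]) (simp add: path_triple_def covering_path_def)
qed

section \<open>Separating chords and stars\<close>

text \<open>A chord is determined by the sum x + y and the weighted sum 2x + y of the ranks of its
  ends in W. Each level set of either label is nested. The levels c and c + m of the sum, as well
  as the levels c and 2c + m of the weighted sum, live on disjoint intervals, so that their
  zigzags can be joined; this makes five paths for each c < m.\<close>

lemma chord_separation:
  fixes F :: "(nat \<times> nat) set"
  assumes W: "W \<subseteq> {..<N}" and FW: "F \<subseteq> W \<times> W" and F: "\<forall>(i, j)\<in>F. Suc i < j"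
  obtains Z where "finite Z" "card Z \<le> 5 * card W"
    "\<forall>z\<in>Z. distinct z \<and> set z \<subseteq> {..<N} \<and> path_edges z \<subseteq> chords F \<union> steps"
    "separates Z (chords F)"
proof -
  have finW: "finite W" using W finite_subset by blast
  then have finF: "finite F" using FW finite_subset by blast
  define m where "m = card W"
  \<comment> \<open>Ranks in \<open>W\<close> replace positions, so that the number of labels
    depends on \<open>card W\<close> and not on \<open>N\<close>.\<close>
  define \<rho> where "\<rho> i = card (W \<inter> {..<i})" for i :: nat
  have \<rho>_mono: "\<rho> i \<le> \<rho> j" if "i \<le> j" for i j
    unfolding \<rho>_def using that finW by (intro card_mono) auto
  have \<rho>_less: "\<rho> i < \<rho> j" if "i < j" "i \<in> W" for i j
    unfolding \<rho>_def using that finW by (intro psubset_card_mono) auto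
  have \<rho>_m: "\<rho> i < m" if "i \<in> W" for i
    unfolding \<rho>_def m_def using that finW by (intro psubset_card_mono) auto
  have \<rho>_inj: "i = j" if "\<rho> i = \<rho> j" "i \<in> W" "j \<in> W" for i j
    using that \<rho>_less[of i j] \<rho>_less[of j i] by (cases i j rule: linorder_cases) auto
  define cls where "cls a k = {(i, j) \<in> F. a * \<rho> i + \<rho> j = k}" for a k :: nat
  have cls: "i < j \<and> j < N \<and> i \<in> W \<and> j \<in> W \<and> \<rho> i < \<rho> j \<and> \<rho> j < m \<and> a * \<rho> i + \<rho> j = k"
    if "(i, j) \<in> cls a k" for i j a k
    using that W FW F \<rho>_less[of i j] \<rho>_m[of j] unfolding cls_def by fastforce
  have finc: "finite (cls a k)" for a k
    using finF unfolding cls_def by (rule rev_finite_subset) auto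
  have chF: "chords (cls a k) \<subseteq> chords F" for a k
    unfolding cls_def chords_def by auto
  have nest: "nested (cls a k)" if "a > 0" for a k
    unfolding nested_def
  proof (intro ballI impI)
    fix e f assume ef: "e \<in> cls a k" "f \<in> cls a k" "e \<noteq> f"
    obtain i j where e: "e = (i, j)" by fastforce
    obtain i' j' where f: "f = (i', j')" by fastforce
    \<comment> \<open>At a fixed label, a larger left rank forces a smaller right rank.\<close>
    have less: "j' < j" if "i < i'" "(i, j) \<in> cls a k" "(i', j') \<in> cls a k" for i j i' j'
    proof (rule ccontr)
      assume "\<not> j' < j"
      then have "\<rho> j \<le> \<rho> j'" by (simp add: \<rho>_mono)
      moreover have "a * \<rho> i < a * \<rho> i'" using \<rho>_less[of i i'] cls that \<open>a > 0\<close> by simp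
      ultimately show False using cls[OF that(2)] cls[OF that(3)] by simp
    qed
    show "encloses e f \<or> encloses f e"
    proof (cases i i' rule: linorder_cases)
      case equal
      then have "\<rho> j = \<rho> j'" using cls[of i j a k] cls[of i' j' a k] ef e f by simp
      then have "j = j'" using \<rho>_inj cls[of i j a k] cls[of i' j' a k] ef e f by simp
      then show ?thesis using equal ef e f by simp
    qed (use less ef e f in auto)
  qed
  have "\<exists>A B B'. path_triple N (cls 1 c) (cls 1 (c + m)) A B B'" for c
  proof (rule path_triple_exists)
    \<comment> \<open>At level \<open>c\<close> the right rank is at most \<open>c\<close>. At level
      \<open>c + m\<close> the right rank is below \<open>m\<close>, so the left rank exceeds
      \<open>c\<close>.\<close>
    show "\<forall>(i, j)\<in>cls 1 c. \<forall>(k, l)\<in>cls 1 (c + m). j < k"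
    proof clarify
      fix i j k l assume "(i, j) \<in> cls 1 c" "(k, l) \<in> cls 1 (c + m)"
      then have "\<rho> j < \<rho> k" using cls[of i j 1 c] cls[of k l 1 "c + m"] by linarith
      then show "j < k" using \<rho>_mono[of k j] by force
    qed
  qed (use finc nest cls in auto)
  then obtain A B B' where T1: "\<And>c. path_triple N (cls 1 c) (cls 1 (c + m)) (A c) (B c) (B' c)"
    by metis
  \<comment> \<open>Likewise for the weighted sum: \<open>\<rho> j\<close> is at most
    \<open>c\<close>, while \<open>2 * \<rho> k\<close> exceeds \<open>2 * c\<close>.\<close>
  have sep2: "j < k" if "(i, j) \<in> cls 2 c" "(k, l) \<in> cls 2 (2 * c + m)" for i j k l c
  proof -
    have "\<rho> j < \<rho> k" using cls[OF that(1)] cls[OF that(2)] by linarith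
    then show "j < k" using \<rho>_mono[of k j] by force
  qed
  have "\<exists>z. covering_path N (chords (cls 2 c \<union> cls 2 (2 * c + m))) z" for c
    by (rule covering_path_exists) (use finc nest cls sep2 in auto)
  then obtain D where D: "\<And>c. covering_path N (chords (cls 2 c \<union> cls 2 (2 * c + m))) (D c)"
    by metis
  \<comment> \<open>The weighted levels from \<open>m\<close> to below \<open>3 * m\<close> have the
    form \<open>2 * c + m\<close> or \<open>2 * c + m + 1\<close>. Those of the second form are not
    joined to any other level and get paths of their own.\<close>
  have "\<exists>z. covering_path N (chords (cls 2 (2 * c + m + 1) \<union> {})) z" for c
    by (rule covering_path_exists) (use finc nest cls in auto)
  then obtain D' where D': "\<And>c. covering_path N (chords (cls 2 (2 * c + m + 1))) (D' c)"
    unfolding Un_empty_right by metis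
  define Z where "Z = A ` {..<m} \<union> (B ` {..<m} \<union> (B' ` {..<m} \<union> (D ` {..<m} \<union> D' ` {..<m})))"
  have T1': "distinct z \<and> set z \<subseteq> {..<N} \<and> path_edges z \<subseteq> chords F \<union> steps"
    if z: "z \<in> {A c, B c, B' c}" for c z
  proof (intro conjI)
    show "distinct z" "set z \<subseteq> {..<N}" using T1[of c] z unfolding path_triple_def by (metis (no_types, lifting))+
    have "path_edges z \<subseteq> chords (cls 1 c) \<union> chords (cls 1 (c + m)) \<union> steps"
      using T1[of c] z unfolding path_triple_def chords_simps by fast
    then show "path_edges z \<subseteq> chords F \<union> steps" using chF[of 1 c] chF[of 1 "c + m"] by blast
  qed
  have "separates Z (chords F)"
    unfolding separates_def
  proof (intro ballI allI impI)
    fix e f assume "e \<in> chords F" and fe: "f \<noteq> e"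
    then obtain i j where ij: "(i, j) \<in> F" "e = {i, j}" by (auto simp: chords_def)
    define s where "s = \<rho> i + \<rho> j"
    define t where "t = 2 * \<rho> i + \<rho> j"
    have s: "(i, j) \<in> cls 1 s" and t: "(i, j) \<in> cls 2 t" using ij by (auto simp: cls_def s_def t_def)
    then have es: "e \<in> chords (cls 1 s)" and et: "e \<in> chords (cls 2 t)"
      unfolding chords_def ij(2) by (auto intro: rev_image_eqI)
    have st: "s < 2 * m" "t < 3 * m" using cls[OF s] cls[OF t] by auto
    show "\<exists>z\<in>Z. e \<in> path_edges z \<and> f \<notin> path_edges z"
    proof (cases "f \<in> chords (cls 1 s)")
      case False
      \<comment> \<open>Two paths through \<open>e\<close> share only chords of its sum level, so an
        \<open>f\<close> outside this level misses one of them.\<close>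
      have "\<exists>x\<in>Z. \<exists>y\<in>Z. e \<in> path_edges x \<and> e \<in> path_edges y \<and>
          path_edges x \<inter> path_edges y \<subseteq> chords (cls 1 s)"
      proof (cases "s < m")
        case True
        then have "A s \<in> Z" "B s \<in> Z" by (auto simp: Z_def)
        moreover have "e \<in> path_edges (A s)" "e \<in> path_edges (B s)"
          "path_edges (A s) \<inter> path_edges (B s) \<subseteq> chords (cls 1 s)"
          using T1[of s] es unfolding path_triple_def chords_simps by auto
        ultimately show ?thesis by blast
      next
        case False
        then have "A (s - m) \<in> Z" "B' (s - m) \<in> Z" using st by (auto simp: Z_def)
        moreover have "e \<in> path_edges (A (s - m))" "e \<in> path_edges (B' (s - m))"
          "path_edges (A (s - m)) \<inter> path_edges (B' (s - m)) \<subseteq> chords (cls 1 s)"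
          using T1[of "s - m"] es False unfolding path_triple_def chords_simps by auto
        ultimately show ?thesis by blast
      qed
      then show ?thesis using False by blast
    next
      case True
      then obtain i' j' where f: "(i', j') \<in> cls 1 s" "f = {i', j'}" by (auto simp: chords_def)
      \<comment> \<open>A chord \<open>f\<close> of the same sum is not a step, so a single covering
        path through \<open>e\<close> avoids it unless \<open>f\<close> belongs to a weighted level
        covered by that path.\<close>
      have not_step: "f \<notin> steps"
      proof -
        have "Suc i' < j'" using f(1) F unfolding cls_def by auto
        then show ?thesis unfolding f(2) steps_def by (auto simp: doubleton_eq_iff)
      qed
      have pair: "(i', j') \<in> cls a k" if "f \<in> chords (cls a k)" for a k
        using that f(2) cls[OF f(1)] cls[of _ _ a k]
        unfolding chords_def by (fastforce simp: doubleton_eq_iff)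
      \<comment> \<open>Subtracting the sum from the weighted sum recovers the left rank, so the two
        labels determine the chord.\<close>
      have not_t: "f \<notin> chords (cls 2 t)"
      proof
        assume "f \<in> chords (cls 2 t)"
        then have "(i', j') \<in> cls 2 t" by (rule pair)
        then have "\<rho> i' = \<rho> i" "\<rho> j' = \<rho> j"
          using cls[OF f(1)] cls[OF s] cls[OF t] cls[of i' j' 2 t] by auto
        then have "i' = i" "j' = j" using \<rho>_inj cls[OF f(1)] cls[OF s] by auto
        then show False using f ij fe by simp
      qed
      \<comment> \<open>A chord entirely to the left of another has a strictly smaller sum. This
        excludes \<open>f\<close> from the other level on a joined path.\<close>
      have apart: False if "j < i' \<or> j' < i"
        using that
      proof
        assume "j < i'"
        then have "\<rho> j < \<rho> i'" using cls[OF s] \<rho>_less by blast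
        then show False using cls[OF f(1)] cls[OF s] by linarith
      next
        assume "j' < i"
        then have "\<rho> j' < \<rho> i" using cls[OF f(1)] \<rho>_less by blast
        then show False using cls[OF f(1)] cls[OF s] by linarith
      qed
      consider "t < m" | c where "c < m" "t = 2 * c + m" | c where "c < m" "t = 2 * c + m + 1"
      proof -
        have "t < m \<or> (\<exists>c<m. t = 2 * c + m) \<or> (\<exists>c<m. t = 2 * c + m + 1)"
          using st(2) by presburger
        then show thesis using that by blast
      qed
      then show ?thesis
      proof cases
        case 1
        have "f \<notin> chords (cls 2 (2 * t + m))"
          using sep2[OF t pair] apart by blast
        then have "e \<in> path_edges (D t)" "f \<notin> path_edges (D t)"
          using D[of t] et not_t not_step unfolding covering_path_def chords_simps by blast+
        moreover have "D t \<in> Z" using 1 by (simp add: Z_def)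
        ultimately show ?thesis by blast
      next
        case (2 c)
        have "f \<notin> chords (cls 2 c)"
          using sep2[OF pair, of c i j] t apart 2 by blast
        then have "e \<in> path_edges (D c)" "f \<notin> path_edges (D c)"
          using 2 D[of c] et not_t not_step unfolding covering_path_def chords_simps by blast+
        moreover have "D c \<in> Z" using 2 by (simp add: Z_def)
        ultimately show ?thesis by blast
      next
        case (3 c)
        then have "e \<in> path_edges (D' c)" "f \<notin> path_edges (D' c)"
          using D'[of c] et not_t not_step unfolding covering_path_def by blast+
        moreover have "D' c \<in> Z" using 3 by (simp add: Z_def)
        ultimately show ?thesis by blast
      qed
    qed
  qed
  moreover have "\<forall>z\<in>Z. distinct z \<and> set z \<subseteq> {..<N} \<and> path_edges z \<subseteq> chords F \<union> steps"
  proof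
    fix z assume "z \<in> Z"
    then consider c where "z \<in> {A c, B c, B' c}" | c where "z = D c" | c where "z = D' c"
      by (auto simp: Z_def)
    then show "distinct z \<and> set z \<subseteq> {..<N} \<and> path_edges z \<subseteq> chords F \<union> steps"
    proof cases
      case (2 c)
      then show ?thesis using D[of c] chF[of 2 c] chF[of 2 "2 * c + m"]
        unfolding covering_path_def chords_simps by blast
    next
      case (3 c)
      then show ?thesis using D'[of c] chF[of 2 "2 * c + m + 1"] unfolding covering_path_def by blast
    qed (rule T1')
  qed
  moreover have "finite Z" by (simp add: Z_def)
  moreover have "card Z \<le> 5 * card W"
  proof -
    have im: "card (g ` {..<m}) \<le> m" for g :: "nat \<Rightarrow> nat list"
      using card_image_le[of "{..<m}" g] by simp
    have "card Z \<le> m + (m + (m + (m + m)))"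
      unfolding Z_def
      by (intro order_trans[OF card_Un_le] add_mono im)
    then show ?thesis by (simp add: m_def)
  qed
  ultimately show thesis using that by blast
qed

section \<open>Separating the edges that meet a vertex set on a path\<close>

text \<open>An edge meeting \<open>S\<close> has both ends among \<open>S\<close> and its
  neighbours, all of which lie on \<open>P\<close>. So it is either one of at most two edges of
  \<open>P\<close> at a vertex of \<open>S\<close>, or a chord of \<open>P\<close> between positions
  that \<open>chord_separation\<close> can take as its \<open>W\<close>.\<close>

lemma star_separation:
  assumes E: "\<forall>e\<in>E. e \<subseteq> V \<and> card e = 2" and P: "vertex_path V E P" and S: "S \<subseteq> set P"
    and nbr: "\<forall>u\<in>S. \<forall>w. {u, w} \<in> E \<longrightarrow> w \<in> set P"
  obtains L where "finite L" "\<forall>xs\<in>L. vertex_path V E xs"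
    "card L \<le> 5 * card (S \<union> {w. \<exists>u\<in>S. {u, w} \<in> E}) + 2 * card S"
    "separates L {e \<in> E. e \<inter> S \<noteq> {}}"
proof -
  define N where "N = S \<union> {w. \<exists>u\<in>S. {u, w} \<in> E}"
  define W where "W = {i. i < length P \<and> P ! i \<in> N}"
  define H where "H = {e \<in> E. e \<inter> S \<noteq> {}}"
  define F where "F = {(i, j). i < j \<and> j < length P \<and> {P ! i, P ! j} \<in> H - path_edges P}"
  have dP: "distinct P" and PE: "path_edges P \<subseteq> E" and PV: "set P \<subseteq> V"
    using P by (auto simp: vertex_path_def)
  have inj: "inj_on ((!) P) {..<length P}" using dP by (simp add: inj_on_nth)
  have NP: "N \<subseteq> set P" using S nbr by (auto simp: N_def)
  have finS: "finite S" using S finite_subset by blast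
  have "card W \<le> card N"
  proof (rule card_inj_on_le)
    show "inj_on ((!) P) W" using inj by (rule inj_on_subset) (auto simp: W_def)
    show "finite N" using NP finite_subset by blast
  qed (auto simp: W_def)
  have H_N: "e \<subseteq> N" if "e \<in> H" for e
  proof -
    from that obtain u where "u \<in> S" "u \<in> e" by (auto simp: H_def)
    moreover have "card e = 2" using E that by (simp add: H_def)
    then obtain x y where "e = {x, y}" by (meson card_2_iff)
    ultimately show ?thesis using that by (auto simp: H_def N_def insert_commute)
  qed
  have "F \<subseteq> W \<times> W" using H_N by (fastforce simp: F_def W_def)
  moreover have "\<forall>(i, j)\<in>F. Suc i < j"
  proof clarify
    fix i j assume ij: "(i, j) \<in> F"
    have "j \<noteq> Suc i"
    proof
      assume "j = Suc i"
      then have "{P ! i, P ! j} \<in> path_edges P" using ij unfolding F_def path_edges_def by blast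
      then show False using ij by (simp add: F_def)
    qed
    then show "Suc i < j" using ij by (simp add: F_def)
  qed
  moreover have "W \<subseteq> {..<length P}" by (auto simp: W_def)
  ultimately obtain Z where Z: "finite Z" "card Z \<le> 5 * card W"
    "\<forall>z\<in>Z. distinct z \<and> set z \<subseteq> {..<length P} \<and> path_edges z \<subseteq> chords F \<union> steps"
    "separates Z (chords F)"
    using chord_separation by metis
  define L1 where "L1 = map ((!) P) ` Z"
  define L2 where "L2 = (\<Union>s\<in>S. (\<lambda>x. [s, x]) ` {x. {s, x} \<in> path_edges P})"
  have "vertex_path V E (map ((!) P) z)" if "z \<in> Z" for z
    unfolding vertex_path_def
  proof (intro conjI)
    have z: "distinct z" "set z \<subseteq> {..<length P}" "path_edges z \<subseteq> chords F \<union> steps"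
      using Z(3) that by auto
    show "distinct (map ((!) P) z)"
      using z inj by (simp add: distinct_map inj_on_subset)
    show "set (map ((!) P) z) \<subseteq> V" using z PV by (auto dest: nth_mem)
    show "path_edges (map ((!) P) z) \<subseteq> E"
    proof
      fix e assume "e \<in> path_edges (map ((!) P) z)"
      then obtain g where g: "g \<in> path_edges z" "e = (!) P ` g" by (auto simp: path_edges_map)
      then consider "g \<in> chords F" | i where "g = {i, Suc i}" using z by (auto simp: steps_def)
      then show "e \<in> E"
      proof cases
        case 1
        then show ?thesis using g by (auto simp: chords_def F_def H_def)
      next
        case (2 i)
        then have "Suc i < length P" using path_edges_subset[OF g(1)] z by auto
        then have "e \<in> path_edges P" using g 2 unfolding path_edges_def by auto
        then show ?thesis using PE by auto
      qed
    qed
  qed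
  moreover have "vertex_path V E xs" if "xs \<in> L2" for xs
  proof -
    from that obtain s x where "xs = [s, x]" "{s, x} \<in> path_edges P" by (auto simp: L2_def)
    moreover from this have "{s, x} \<in> E" using PE by auto
    ultimately show ?thesis using E by (cases "s = x") (auto simp: vertex_path_def)
  qed
  ultimately have "\<forall>xs\<in>L1 \<union> L2. vertex_path V E xs" by (auto simp: L1_def)
  moreover have "finite (L1 \<union> L2)"
    using Z(1) finS card_path_neighbours(1)[OF dP] by (simp add: L1_def L2_def)
  moreover have "card (L1 \<union> L2) \<le> 5 * card N + 2 * card S"
  proof -
    have "card L1 \<le> 5 * card N"
      using card_image_le[OF Z(1), of "map ((!) P)"] Z(2) \<open>card W \<le> card N\<close> by (simp add: L1_def)
    moreover have "card L2 \<le> (\<Sum>s\<in>S. card ((\<lambda>x. [s, x]) ` {x. {s, x} \<in> path_edges P}))"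
      unfolding L2_def by (rule card_UN_le[OF finS])
    moreover have "\<dots> \<le> (\<Sum>s\<in>S. 2)"
      by (intro sum_mono order_trans[OF card_image_le] card_path_neighbours[OF dP])
    moreover have "card (L1 \<union> L2) \<le> card L1 + card L2" by (rule card_Un_le)
    ultimately show ?thesis by simp
  qed
  moreover have "separates (L1 \<union> L2) H"
  proof -
    have "separates L1 (H - path_edges P)"
      unfolding separates_def
    proof (intro ballI allI impI)
      fix e f assume e: "e \<in> H - path_edges P" and fe: "f \<noteq> e"
      have "card e = 2" using E e by (simp add: H_def)
      then obtain x y where xy: "e = {x, y}" "x \<noteq> y" by (meson card_2_iff)
      then have "x \<in> set P" "y \<in> set P" using H_N[of e] e NP by auto
      then obtain i j where "i < length P" "j < length P" "x = P ! i" "y = P ! j"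
        by (metis in_set_conv_nth)
      then obtain k l where kl: "k < l" "l < length P" "e = {P ! k, P ! l}"
        using xy by (cases i j rule: linorder_cases) (auto simp: insert_commute)
      then have "(k, l) \<in> F" using e by (simp add: F_def)
      then have chord: "{k, l} \<in> chords F" by (force simp: chords_def)
      \<comment> \<open>As \<open>f\<close> is an arbitrary set, it is pulled back to positions:
        \<open>g\<close> is the only candidate for a preimage among them.\<close>
      define g where "g = {i. i < length P \<and> P ! i \<in> f}"
      have pre: "h = g" if "h \<subseteq> {..<length P}" "f = (!) P ` h" for h
        using that inj unfolding g_def by (auto simp: inj_on_def)
      \<comment> \<open>If \<open>g = {k, l}\<close>, separating the chord from the empty set still
        supplies a path through it.\<close>
      obtain z where z: "z \<in> Z" "{k, l} \<in> path_edges z" "g = {k, l} \<or> g \<notin> path_edges z"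
        using Z(4) chord unfolding separates_def by (metis insertI1 insert_not_empty)
      have "e \<in> path_edges (map ((!) P) z)"
        unfolding path_edges_map by (rule rev_image_eqI[OF z(2)]) (simp add: kl(3))
      moreover have "f \<notin> path_edges (map ((!) P) z)"
      proof
        assume "f \<in> path_edges (map ((!) P) z)"
        then obtain h where h: "h \<in> path_edges z" "f = (!) P ` h" by (auto simp: path_edges_map)
        then have "h = g" using pre path_edges_subset[OF h(1)] Z(3) z(1) by blast
        then have "f = e" using z h kl by auto
        then show False using fe by simp
      qed
      ultimately show "\<exists>xs\<in>L1. e \<in> path_edges xs \<and> f \<notin> path_edges xs"
        using z(1) by (auto simp: L1_def)
    qed
    moreover have "separates L2 (H \<inter> path_edges P)"
      unfolding separates_def
    proof (intro ballI allI impI)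
      fix e f assume e: "e \<in> H \<inter> path_edges P" and fe: "f \<noteq> e"
      from e obtain s where "s \<in> S" "s \<in> e" by (auto simp: H_def)
      moreover have "card e = 2" using E e by (simp add: H_def)
      then obtain x y where "e = {x, y}" by (meson card_2_iff)
      ultimately obtain w where "e = {s, w}" by (auto simp: insert_commute)
      then have "[s, w] \<in> L2" using e \<open>s \<in> S\<close> by (auto simp: L2_def)
      then show "\<exists>xs\<in>L2. e \<in> path_edges xs \<and> f \<notin> path_edges xs"
        using \<open>e = {s, w}\<close> fe by (intro bexI[of _ "[s, w]"]) auto
    qed
    ultimately have "separates (L1 \<union> L2) ((H - path_edges P) \<union> (H \<inter> path_edges P))"
      by (rule separates_Un)
    then show ?thesis by (rule separates_mono) auto
  qed
  ultimately show thesis using that unfolding N_def H_def by blast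
qed

section \<open>Induction on the number of vertices and passage to path graphs\<close>

lemma separating_vertex_paths:
  assumes "finite V" "\<forall>e\<in>E. e \<subseteq> V \<and> card e = 2"
  shows "\<exists>L. finite L \<and> card L \<le> 19 * card V \<and> (\<forall>xs\<in>L. vertex_path V E xs) \<and> separates L E"
  using assms
proof (induction "card V" arbitrary: V E rule: less_induct)
  case less
  show ?case
  proof (cases "V = {}")
    case True
    then have "E = {}" using less.prems by fastforce
    then show ?thesis by (intro exI[of _ "{}"]) (simp add: separates_def)
  next
    case False
    obtain P S where P: "vertex_path V E P" and S: "S \<noteq> {}" "S \<subseteq> set P"
      and nbr: "\<forall>u\<in>S. \<forall>w. {u, w} \<in> E \<longrightarrow> w \<in> set P"
      and card3: "card (S \<union> {w. \<exists>u\<in>S. {u, w} \<in> E}) \<le> 3 * card S"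
      using posa[OF less.prems(1) False less.prems(2)] by blast
    obtain L where L: "finite L" "\<forall>xs\<in>L. vertex_path V E xs"
      "card L \<le> 5 * card (S \<union> {w. \<exists>u\<in>S. {u, w} \<in> E}) + 2 * card S"
      "separates L {e \<in> E. e \<inter> S \<noteq> {}}"
      using star_separation[OF less.prems(2) P S(2) nbr] by blast
    have SV: "S \<subseteq> V" using S P by (auto simp: vertex_path_def)
    have "finite S" using SV less.prems(1) finite_subset by blast
    have cV: "card (V - S) = card V - card S" "card S \<le> card V" "card S > 0"
      using SV S(1) less.prems(1) \<open>finite S\<close>
      by (auto simp: card_Diff_subset card_mono card_gt_0_iff)
    define E' where "E' = {e \<in> E. e \<inter> S = {}}"
    have "\<exists>L. finite L \<and> card L \<le> 19 * card (V - S) \<and>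
        (\<forall>xs\<in>L. vertex_path (V - S) E' xs) \<and> separates L E'"
      by (rule less.hyps) (use cV less.prems in \<open>auto simp: E'_def\<close>)
    then obtain L' where L': "finite L'" "card L' \<le> 19 * card (V - S)"
      "\<forall>xs\<in>L'. vertex_path (V - S) E' xs" "separates L' E'" by blast
    have "separates (L \<union> L') E"
      by (rule separates_mono[OF separates_Un[OF L(4) L'(4)]]) (auto simp: E'_def)
    moreover have "\<forall>xs\<in>L \<union> L'. vertex_path V E xs"
      using L(2) L'(3) unfolding vertex_path_def E'_def by blast
    \<comment> \<open>Here \<open>L\<close> has at most \<open>5 * 3 + 2 = 17\<close> paths for each
      vertex of \<open>S\<close>, within the allowance of 19.\<close>
    moreover have "card (L \<union> L') \<le> 19 * card V"
      using card_Un_le[of L L'] L(3) L'(2) card3 cV by simp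
    ultimately show ?thesis using L(1) L'(1) by blast
  qed
qed

theorem theorem2:
  fixes G :: "'a ugraph" and n :: nat
  assumes "finite_simple_graph G" and "card (verts G) = n"
  shows "\<exists>\<P>. strongly_separating_path_system G \<P> \<and> finite \<P> \<and> card \<P> \<le> 19 * n"
proof -
  have G: "finite (verts G)" "\<forall>e\<in>edges G. e \<subseteq> verts G \<and> card e = 2"
    using assms(1) by (auto simp: finite_simple_graph_def)
  obtain L where L: "finite L" "card L \<le> 19 * n"
    "\<forall>xs\<in>L. vertex_path (verts G) (edges G) xs" "separates L (edges G)"
    using separating_vertex_paths[OF G] assms(2) by auto
  define graph :: "'a list \<Rightarrow> 'a ugraph" where
    "graph xs = \<lparr>verts = set xs, edges = path_edges xs\<rparr>" for xs
  define \<P> where "\<P> = graph ` (L - {[]})"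
  have paths: "path_in G (graph xs)" if xs: "xs \<in> L - {[]}" for xs
  proof -
    have vp: "distinct xs" "set xs \<subseteq> verts G" "path_edges xs \<subseteq> edges G"
      using L(3) xs by (auto simp: vertex_path_def)
    then have "path_graph (graph xs)"
      using xs unfolding path_graph_def graph_def path_edges_def by auto
    moreover have "finite_simple_graph (graph xs)"
      using vp(3) G(2) path_edges_subset by (fastforce simp: finite_simple_graph_def graph_def)
    ultimately show ?thesis
      using vp by (simp add: path_in_def subgraph_def graph_def)
  qed
  \<comment> \<open>One-sided separation; its use for \<open>e\<close> against \<open>f\<close> and
    for \<open>f\<close> against \<open>e\<close> gives the strong form.\<close>
  have sep: "\<exists>Q\<in>\<P>. e \<in> edges Q \<and> f \<notin> edges Q"
    if ef: "e \<in> edges G" "f \<noteq> e" for e f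
  proof -
    obtain xs where "xs \<in> L" "e \<in> path_edges xs" "f \<notin> path_edges xs"
      using L(4) ef unfolding separates_def by blast
    moreover from this have "xs \<noteq> []" by auto
    ultimately show ?thesis by (auto simp: \<P>_def graph_def)
  qed
  have "strongly_separating_path_system G \<P>"
    unfolding strongly_separating_path_system_def
  proof (intro conjI ballI impI)
    show "path_in G Q" if "Q \<in> \<P>" for Q using that paths unfolding \<P>_def by auto
    fix e f assume ef: "e \<in> edges G" "f \<in> edges G" "e \<noteq> f"
    obtain Q where "Q \<in> \<P>" "e \<in> edges Q" "f \<notin> edges Q" using sep[of e f] ef by auto
    moreover obtain R where "R \<in> \<P>" "f \<in> edges R" "e \<notin> edges R" using sep[of f e] ef by auto
    ultimately show "\<exists>P\<^sub>e\<in>\<P>. \<exists>P\<^sub>f\<in>\<P>.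
        e \<in> edges P\<^sub>e \<and> e \<notin> edges P\<^sub>f \<and> f \<in> edges P\<^sub>f \<and> f \<notin> edges P\<^sub>e"
      by (intro bexI[of _ Q] bexI[of _ R] conjI)
  qed
  moreover have "finite \<P>" "card \<P> \<le> 19 * n"
    using L(1,2) card_image_le[of "L - {[]}" graph] card_mono[of L "L - {[]}"]
    by (auto simp: \<P>_def)
  ultimately show ?thesis by blast
qed

end
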